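(* Let $I=(i_1,\ldots,i_r)$ be a composition of $n$, and let $D_{\le I}$ be the set of $\sigma\in\mathfrak S_n$ whose descent set $\{j:\sigma(j)>\sigma(j+1)\}$ is contained in $\{i_1,i_1+i_2,\ldots,i_1+\cdots+i_{r-1}\}$. Then $$\sum_{\sigma\in D_{\le I}} x_{\operatorname{Sc}(\sigma^{-1})}=\sum_{\sigma\in \operatorname{id}_{i_1}\Cup\cdots\Cup\operatorname{id}_{i_r}} x_{\operatorname{Sc}(\sigma)}=h_{i_1}(X_{i_2+\cdots+i_r})\,h_{i_2}(X_{i_3+\cdots+i_r})\cdots h_{i_{r-1}}(X_{i_r})\,h_{i_r}(X_0).$$
   Context: Permutations are words $\sigma=\sigma(1)\cdots\sigma(n)$. The set $\operatorname{id}_{i_1}\Cup\cdots\Cup\operatorname{id}_{i_r}$ (iterated shifted shuffle of identity permutations) is the set of $\sigma\in\mathfrak S_n$ such that, for each $p$, the letters $s_{p-1}+1,s_{p-1}+2,\ldots,s_p$ (where $s_p=i_1+\cdots+i_p$, $s_0=0$) appear in $\sigma$ from left to right in increasing order; it is the set of inverses of elements of $D_{\le I}$. The $x_0,x_1,\ldots$ are commuting indeterminates; for $c=(c_1,\ldots,c_n)$, $x_c=x_{c_1}\cdots x_{c_n}$. $X_m=\{x_0,\ldots,x_m\}$ and $h_k(X_m)$ is the complete homogeneous symmetric polynomial of degree $k$ in $x_0,\ldots,x_m$. Saillance code: $\operatorname{Sc}(\sigma)=(a_1,\ldots,a_n)$ where, if some letter greater than $i$ lies to the left of $i$ in $\sigma$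 and $b$ is the rightmost such letter, $a_i=n+1-b$ (the number of letters $\ge b$); otherwise $a_i=0$. *)

theory Defs
  imports "HOL-Library.Poly_Mapping" "HOL-Combinatorics.Permutations"
begin

text \<open>
  A polynomial in the indeterminates \<open>x\<^sub>0, x\<^sub>1, \<dots>\<close> is a finitely supported map from
  exponent vectors (finitely supported maps from indices to exponents) to coefficients;
  the multiplication of \<^type>\<open>poly_mapping\<close> is convolution.
\<close>

type_synonym 'a mpoly = "(nat \<Rightarrow>\<^sub>0 nat) \<Rightarrow>\<^sub>0 'a"

definition indet :: "nat \<Rightarrow> 'a::comm_ring_1 mpoly"
  where "indet i = Poly_Mapping.single (Poly_Mapping.single i 1) 1"

definition x_word :: "nat list \<Rightarrow> 'a::comm_ring_1 mpoly"
  where "x_word c = prod_list (map indet c)"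

text \<open>
  \<open>complete_hom k m\<close> is \<open>h\<^sub>k(X\<^sub>m)\<close>, the sum of \<open>x\<^bsub>j\<^sub>1\<^esub> \<cdots> x\<^bsub>j\<^sub>k\<^esub>\<close> over all
  \<open>0 \<le> j\<^sub>1 \<le> \<dots> \<le> j\<^sub>k \<le> m\<close>. Note that there are \<open>m + 1\<close> variables.
\<close>

definition complete_hom :: "nat \<Rightarrow> nat \<Rightarrow> 'a::comm_ring_1 mpoly"
  where "complete_hom k m = (\<Sum>js | length js = k \<and> sorted js \<and> set js \<subseteq> {0..m}. x_word js)"

definition is_composition :: "nat list \<Rightarrow> nat \<Rightarrow> bool"
  where "is_composition I n \<longleftrightarrow> (\<forall>i\<in>set I. i > 0) \<and> sum_list I = n"

definition psum :: "nat list \<Rightarrow> nat \<Rightarrow> nat"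
  where "psum I p = sum_list (take p I)"

text \<open>
  Elements of \<open>\<SS>\<^sub>n\<close> are functions \<open>\<sigma>\<close> with \<open>\<sigma> permutes {1..n}\<close>, read as the word
  \<open>\<sigma> 1, \<dots>, \<sigma> n\<close>; thus \<open>inv \<sigma> i\<close> is the position of the letter \<open>i\<close>.
\<close>

definition descent_set :: "nat \<Rightarrow> (nat \<Rightarrow> nat) \<Rightarrow> nat set"
  where "descent_set n \<sigma> = {j. 1 \<le> j \<and> j < n \<and> \<sigma> j > \<sigma> (j + 1)}"

definition D_le :: "nat list \<Rightarrow> (nat \<Rightarrow> nat) set"
  where "D_le I = {\<sigma>. \<sigma> permutes {1..sum_list I} \<and>
    descent_set (sum_list I) \<sigma> \<subseteq> {psum I p | p. 1 \<le> p \<and> p < length I}}"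

text \<open>The iterated shifted shuffle of the identity permutations of sizes \<open>i\<^sub>1, \<dots>, i\<^sub>r\<close>.\<close>

definition shuffle_ids :: "nat list \<Rightarrow> (nat \<Rightarrow> nat) set"
  where "shuffle_ids I = {\<sigma>. \<sigma> permutes {1..sum_list I} \<and>
    (\<forall>p. 1 \<le> p \<and> p \<le> length I \<longrightarrow> strict_mono_on {psum I (p - 1) + 1..psum I p} (inv \<sigma>))}"

text \<open>The positions to the left of the letter \<open>i\<close> that hold a letter greater than \<open>i\<close>.\<close>

definition larger_left :: "(nat \<Rightarrow> nat) \<Rightarrow> nat \<Rightarrow> nat set"
  where "larger_left \<sigma> i = {j. 1 \<le> j \<and> j < inv \<sigma> i \<and> \<sigma> j > i}"

definition saillance_code :: "nat \<Rightarrow> (nat \<Rightarrow> nat) \<Rightarrow> nat list"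
  where "saillance_code n \<sigma> =
    map (\<lambda>i. if larger_left \<sigma> i = {} then 0 else n + 1 - \<sigma> (Max (larger_left \<sigma> i))) [1..<n + 1]"

end

theory Submission
  imports Defs
begin

text \<open>
  Build a permutation by inserting its letters in decreasing order. When \<open>i\<close> is inserted, its
  entry of the saillance code depends only on its left neighbour, so it is the label of the gap
  receiving \<open>i\<close>, where the leading gap has label \<open>0\<close> and the gap after \<open>b\<close> has label \<open>n + 1 - b\<close>.
  If a block of \<open>k\<close> letters has to appear in increasing order, each of its letters is inserted to
  the left of the preceding ones. Hence all of them choose among the \<open>m + 1\<close> gaps of the word of
  the \<open>m\<close> larger letters, and only the multiset of chosen gaps matters. Whatever that word is, the
  labels of its gaps are \<open>0, \<dots>, m\<close>, so the block contributes the factor \<open>h\<^sub>k(X\<^sub>m)\<close>.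
\<close>

section \<open>Complete homogeneous sums over finite index sets\<close>

text \<open>Indexing by multisets makes the value depend only on the set of gap labels, not on the
  order in which the gaps occur in a word.\<close>

definition hsum :: "(nat \<Rightarrow> 'b::comm_semiring_1) \<Rightarrow> nat \<Rightarrow> nat set \<Rightarrow> 'b"
  where "hsum X k S = (\<Sum>M\<in>multisets_of_size S k. \<Prod>j\<in>#M. X j)"

lemma hsum_0 [simp]: "hsum X 0 S = 1"
  by (simp add: hsum_def)

lemma hsum_empty [simp]: "hsum X (Suc k) {} = 0"
  by (simp add: hsum_def)

text \<open>Split the multisets by whether they contain \<open>g\<close>. Removing one copy of
  \<open>g\<close> leaves an arbitrary multiset of size \<open>k\<close> that may still contain
  \<open>g\<close>.\<close>

lemma hsum_insert:
  assumes "finite S" "g \<notin> S"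
  shows "hsum X (Suc k) (insert g S) = X g * hsum X k (insert g S) + hsum X (Suc k) S"
proof -
  let ?A = "add_mset g ` multisets_of_size (insert g S) k"
  have eq: "multisets_of_size (insert g S) (Suc k) = ?A \<union> multisets_of_size S (Suc k)"
  proof (intro set_eqI iffI)
    fix M assume M: "M \<in> multisets_of_size (insert g S) (Suc k)"
    show "M \<in> ?A \<union> multisets_of_size S (Suc k)"
    proof (cases "g \<in># M")
      case True
      then obtain M' where "M = add_mset g M'" by (metis mset_add)
      with M show ?thesis by (auto simp: multisets_of_size_def)
    next
      case False
      with M show ?thesis by (auto simp: multisets_of_size_def)
    qed
  qed (auto simp: multisets_of_size_def)
  have "hsum X (Suc k) (insert g S)
      = (\<Sum>M\<in>?A. \<Prod>j\<in>#M. X j) + (\<Sum>M\<in>multisets_of_size S (Suc k). \<Prod>j\<in>#M. X j)"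
    unfolding hsum_def eq using assms
    by (intro sum.union_disjoint finite_imageI finite_multisets_of_size)
       (auto simp: multisets_of_size_def)
  also have "(\<Sum>M\<in>?A. \<Prod>j\<in>#M. X j) = X g * hsum X k (insert g S)"
    by (subst sum.reindex) (auto simp: hsum_def sum_distrib_left inj_on_def)
  finally show ?thesis by (simp add: hsum_def)
qed

lemma hsum_singleton [simp]: "hsum X k {g} = X g ^ k"
  by (induction k) (auto simp: hsum_insert)

text \<open>Each multiset has exactly one sorted listing.\<close>

lemma complete_hom_eq_hsum: "complete_hom k m = hsum indet k {0..m}"
proof -
  have "hsum indet k {0..m} =
      (\<Sum>js | length js = k \<and> sorted js \<and> set js \<subseteq> {0..m}. x_word js :: 'a mpoly)"
    unfolding hsum_def
    by (rule sum.reindex_bij_witness[of _ mset sorted_list_of_multiset])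
       (auto simp: multisets_of_size_def x_word_def sorted_sort_id
          simp flip: prod_mset_prod_list size_mset)
  then show ?thesis by (simp add: complete_hom_def)
qed

section \<open>Gap codes and the contribution of a single block\<close>

text \<open>For a letter \<open>i\<close> of \<open>w\<close> this is \<open>N - b\<close>, where \<open>b\<close> is the rightmost letter greater
  than \<open>i\<close> to the left of \<open>i\<close>, and the default \<open>g\<close> if there is no such letter.\<close>

fun gap_code :: "nat \<Rightarrow> nat \<Rightarrow> nat list \<Rightarrow> nat \<Rightarrow> nat" where
  "gap_code N g [] i = g"
| "gap_code N g (z # zs) i = (if z = i then g else gap_code N (if z > i then N - z else g) zs i)"

text \<open>Only letters greater than \<open>i\<close> update the default, and the filter keeps all
  of them as well as \<open>i\<close>. Hence inserting a block of smaller letters does not disturb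
  the codes already present.\<close>

lemma gap_code_filter:
  "t < i \<Longrightarrow> gap_code N g (filter (\<lambda>b. b > t) w) i = gap_code N g w i"
  by (induction N g w i rule: gap_code.induct) auto

lemma gap_code_append:
  "i \<notin> set us \<Longrightarrow>
    gap_code N g (us @ i # vs) i = fold (\<lambda>z g. if z > i then N - z else g) us g"
  by (induction us arbitrary: g) auto

lemma gap_code_increasing:
  "sorted_wrt (<) xs \<Longrightarrow> i \<in> set xs \<Longrightarrow> gap_code N g xs i = g"
  by (induction xs) auto

text \<open>Splitting the shuffles by their first letter gives the recurrence \<open>hsum_insert\<close> for the
  leading gap \<open>g\<close>.\<close>

lemma sum_shuffles_gap_code:
  fixes X :: "nat \<Rightarrow> 'b::comm_semiring_1"
  assumes "sorted_wrt (<) xs" "\<forall>x\<in>set xs. \<forall>y\<in>set ys. x < y"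
    and "distinct (g # map (\<lambda>b. N - b) ys)"
  shows "(\<Sum>w\<in>shuffles xs ys. \<Prod>i\<leftarrow>xs. X (gap_code N g w i))
    = hsum X (length xs) (insert g ((\<lambda>b. N - b) ` set ys))"
  using assms
proof (induction xs ys arbitrary: g rule: shuffles.induct)
  case (1 ys)
  then show ?case by simp
next
  case (2 xs)
  have "(\<Prod>i\<leftarrow>xs. X (gap_code N g (xs) i)) = (\<Prod>i\<leftarrow>xs. X g)"
    using 2 by (intro arg_cong[of _ _ prod_list] map_cong refl arg_cong[of _ _ X] gap_code_increasing) auto
  also have "\<dots> = X g ^ length (xs)"
    by (simp only: map_replicate_const prod_list_replicate)
  finally show ?case by simp
next
  case (3 x xs y ys)
  let ?P = "\<lambda>g xs w. \<Prod>i\<leftarrow>xs. X (gap_code N g w i)"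
  have xy: "x < y" and xs: "\<forall>i\<in>set xs. x < i" using "3.prems" by auto
  have disj: "(#) x ` shuffles xs (y # ys) \<inter> (#) y ` shuffles (x # xs) ys = {}"
    using xy by auto
  \<comment> \<open>The letter \<open>x\<close> takes the current gap \<open>g\<close>. Being
    smaller than the rest of its block, it leaves that gap available to them.\<close>
  have A: "?P g (x # xs) (x # w) = X g * ?P g xs w" for w
  proof -
    have "map (\<lambda>i. X (gap_code N g (x # w) i)) xs = map (\<lambda>i. X (gap_code N g w i)) xs"
      using xs by auto
    then show ?thesis by (simp only: list.map prod_list.Cons gap_code.simps simp_thms if_True)
  qed
  \<comment> \<open>The letter \<open>y\<close> exceeds the whole block, so passing it closes the
    gap \<open>g\<close> and opens the gap \<open>N - y\<close> for every letter of the
    block.\<close>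
  have B: "?P g (x # xs) (y # w) = ?P (N - y) (x # xs) w" for w
  proof -
    have "map (\<lambda>i. X (gap_code N g (y # w) i)) (x # xs) = map (\<lambda>i. X (gap_code N (N - y) w i)) (x # xs)"
      using "3.prems" by (intro map_cong) force+
    then show ?thesis by (simp only:)
  qed
  have "(\<Sum>w\<in>shuffles (x # xs) (y # ys). ?P g (x # xs) w)
     = (\<Sum>w\<in>shuffles xs (y # ys). ?P g (x # xs) (x # w))
      + (\<Sum>w\<in>shuffles (x # xs) ys. ?P g (x # xs) (y # w))"
    unfolding shuffles.simps using disj
    by (subst sum.union_disjoint) (auto simp del: list.map prod_list.Cons gap_code.simps simp: sum.reindex)
  also have "\<dots> = X g * (\<Sum>w\<in>shuffles xs (y # ys). ?P g xs w)
      + (\<Sum>w\<in>shuffles (x # xs) ys. ?P (N - y) (x # xs) w)"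
    by (simp only: A B sum_distrib_left)
  also have "(\<Sum>w\<in>shuffles xs (y # ys). ?P g xs w)
      = hsum X (length xs) (insert g ((\<lambda>b. N - b) ` set (y # ys)))"
    using "3.prems" by (intro "3.IH"(1)) auto
  also have "(\<Sum>w\<in>shuffles (x # xs) ys. ?P (N - y) (x # xs) w)
      = hsum X (length (x # xs)) (insert (N - y) ((\<lambda>b. N - b) ` set ys))"
    using "3.prems" by (intro "3.IH"(2)) auto
  also have "X g * hsum X (length xs) (insert g ((\<lambda>b. N - b) ` set (y # ys)))
      + hsum X (length (x # xs)) (insert (N - y) ((\<lambda>b. N - b) ` set ys))
      = hsum X (length (x # xs)) (insert g ((\<lambda>b. N - b) ` set (y # ys)))"
    \<comment> \<open>Here \<open>hsum_insert\<close> is used with the label set of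
      \<open>y # ys\<close>; the distinctness assumption guarantees that \<open>g\<close> lies
      outside it.\<close>
    using "3.prems" by (subst list.size, simp only: add_Suc_right add_0_right, subst hsum_insert) auto
  finally show ?case .
qed

section \<open>Words of the iterated shuffle and the product formula\<close>

text \<open>The words of the iterated shifted shuffle, with all letters shifted by \<open>s\<close>.\<close>

fun shuffle_words :: "nat \<Rightarrow> nat list \<Rightarrow> nat list set" where
  "shuffle_words s [] = {[]}"
| "shuffle_words s (i # I) = (\<Union>w\<in>shuffle_words (s + i) I. shuffles [s + 1..<s + i + 1] w)"

lemma finite_shuffle_words [simp]: "finite (shuffle_words s I)"
  by (induction s I rule: shuffle_words.induct) auto

lemma shuffle_words_set:
  "w \<in> shuffle_words s I \<Longrightarrow> distinct w \<and> set w = {s + 1..s + sum_list I}"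
proof (induction s I arbitrary: w rule: shuffle_words.induct)
  case (2 s i I)
  then obtain w' where w': "w' \<in> shuffle_words (s + i) I" "w \<in> shuffles [s + 1..<s + i + 1] w'"
    by auto
  with 2 have "distinct w'" "set w' = {s + i + 1..s + i + sum_list I}" by auto
  moreover have "set [s + 1..<s + i + 1] = {s + 1..s + i}" by auto
  ultimately show ?case
    using distinct_disjoint_shuffles[OF _ _ _ w'(2)] set_shuffles[OF w'(2)]
    by (auto simp del: upt_Suc set_upt)
qed auto

text \<open>The threshold \<open>s + i\<close> separates the letters of the two shuffled words, so
  both can be recovered from the shuffle.\<close>

lemma filter_shuffle_block:
  assumes "w \<in> shuffles [s + 1..<s + i + 1] w'" "\<forall>y\<in>set w'. s + i < y"
  shows "filter (\<lambda>b. b > s + i) w = w'" "filter (\<lambda>b. b \<le> s + i) w = [s + 1..<s + i + 1]"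
proof -
  have disj: "set [s + 1..<s + i + 1] \<inter> set w' = {}" using assms(2) by auto
  have w: "set w = set [s + 1..<s + i + 1] \<union> set w'" using set_shuffles[OF assms(1)] .
  have "filter (\<lambda>b. b > s + i) w = filter (\<lambda>b. b \<in> set w') w"
    using w assms(2) by (intro filter_cong) auto
  then show "filter (\<lambda>b. b > s + i) w = w'"
    using filter_shuffles_disjoint2[OF disj assms(1)] by simp
  have "filter (\<lambda>b. b \<le> s + i) w = filter (\<lambda>b. b \<in> set [s + 1..<s + i + 1]) w"
    using w assms(2) by (intro filter_cong) auto
  then show "filter (\<lambda>b. b \<le> s + i) w = [s + 1..<s + i + 1]"
    using filter_shuffles_disjoint1[OF disj assms(1)] by simp
qed

text \<open>The first block holds the smallest letters and is inserted last. Its factor is the same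
  for every word of the later blocks, so it can be pulled out. The bound \<open>N\<close> stays
  fixed along the recursion, since \<open>s\<close> grows by what the composition loses.\<close>

lemma sum_shuffle_words_gap_code:
  fixes X :: "nat \<Rightarrow> 'b::comm_semiring_1"
  assumes "N = s + sum_list I + 1"
  shows "(\<Sum>w\<in>shuffle_words s I. \<Prod>i\<leftarrow>[s + 1..<N]. X (gap_code N 0 w i))
    = (\<Prod>p<length I. hsum X (I ! p) {0..sum_list (drop (p + 1) I)})"
  using assms
proof (induction s I rule: shuffle_words.induct)
  case (2 s i I)
  let ?xs = "[s + 1..<s + i + 1]"
  let ?P = "\<lambda>l w. \<Prod>i\<leftarrow>l. X (gap_code N 0 w i)"
  have N: "N = s + i + sum_list I + 1" using 2 by simp
  have large: "\<forall>y\<in>set w'. s + i < y" if "w' \<in> shuffle_words (s + i) I" for w'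
    using shuffle_words_set[OF that] by auto
  have "[s + 1..<N] = ?xs @ [s + i + 1..<N]"
    using N upt_add_eq_append[of "s + 1" "s + i + 1" "sum_list I"] by (simp add: add_ac)
  then have split: "?P [s + 1..<N] w = ?P ?xs w * ?P [s + i + 1..<N] w'"
    if "w' \<in> shuffle_words (s + i) I" "w \<in> shuffles ?xs w'" for w w'
  proof -
    have "map (\<lambda>i. X (gap_code N 0 w i)) [s + i + 1..<N]
        = map (\<lambda>i. X (gap_code N 0 w' i)) [s + i + 1..<N]"
      using gap_code_filter[of "s + i" _ N 0 w] filter_shuffle_block(1)[OF that(2) large[OF that(1)]]
      by (intro map_cong) auto
    with \<open>[s + 1..<N] = _\<close> show ?thesis by (simp del: upt_Suc map_eq_conv)
  qed
  have inner: "(\<Sum>w\<in>shuffles ?xs w'. ?P ?xs w) = hsum X i {0..sum_list I}"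
    if w': "w' \<in> shuffle_words (s + i) I" for w'
  proof -
    have w: "distinct w'" "set w' = {s + i + 1..s + i + sum_list I}"
      using shuffle_words_set[OF w'] by auto
    \<comment> \<open>With \<open>m = sum_list I\<close>, the letters of \<open>w'\<close> are
      \<open>N - m\<close> to \<open>N - 1\<close>, so their labels run through 1 to
      \<open>m\<close>; the leading gap supplies 0.\<close>
    have "insert 0 ((\<lambda>b. N - b) ` set w') = {0..sum_list I}"
    proof (intro set_eqI iffI)
      fix a assume "a \<in> {0..sum_list I}"
      then have "a = 0 \<or> (N - a \<in> set w' \<and> a = N - (N - a))" using w N by auto
      then show "a \<in> insert 0 ((\<lambda>b. N - b) ` set w')" by blast
    qed (use w N in auto)
    moreover have "distinct (0 # map (\<lambda>b. N - b) w')"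
      using w N by (auto simp: distinct_map inj_on_def)
    moreover have "\<forall>x\<in>set ?xs. \<forall>y\<in>set w'. x < y"
      using large[OF w'] by force
    ultimately show ?thesis
      using sum_shuffles_gap_code[of ?xs w' 0 N X] by (simp add: sorted_wrt_upt del: upt_Suc)
  qed
  \<comment> \<open>Filtering a common shuffle would return both \<open>v\<close> and
    \<open>w\<close>.\<close>
  have disj: "shuffles ?xs v \<inter> shuffles ?xs w = {}"
    if "v \<in> shuffle_words (s + i) I" "w \<in> shuffle_words (s + i) I" "v \<noteq> w" for v w
    using filter_shuffle_block(1)[OF _ large[OF that(1)]]
      filter_shuffle_block(1)[OF _ large[OF that(2)]] that(3) by blast
  have "(\<Sum>w\<in>shuffle_words s (i # I). ?P [s + 1..<N] w)
      = (\<Sum>w'\<in>shuffle_words (s + i) I. \<Sum>w\<in>shuffles ?xs w'. ?P [s + 1..<N] w)"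
    unfolding shuffle_words.simps using disj by (intro sum.UNION_disjoint) auto
  also have "\<dots> = (\<Sum>w'\<in>shuffle_words (s + i) I. (\<Sum>w\<in>shuffles ?xs w'. ?P ?xs w) * ?P [s + i + 1..<N] w')"
    unfolding sum_distrib_right by (intro sum.cong refl split)
  also have "\<dots> = hsum X i {0..sum_list I} * (\<Sum>w'\<in>shuffle_words (s + i) I. ?P [s + i + 1..<N] w')"
    unfolding sum_distrib_left by (intro sum.cong refl arg_cong2[of _ _ _ _ "(*)"] inner)
  also have "\<dots> = hsum X i {0..sum_list I}
      * (\<Prod>p<length I. hsum X (I ! p) {0..sum_list (drop (p + 1) I)})"
    using 2 by simp
  also have "\<dots> = (\<Prod>p<length (i # I). hsum X ((i # I) ! p) {0..sum_list (drop (p + 1) (i # I))})"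
    by (simp add: prod.lessThan_Suc_shift del: prod.lessThan_Suc)
  finally show ?case .
qed simp

text \<open>Peel off the block of smallest letters. Since the letters are prescribed and distinct, a
  sorted restriction to a block is already the full interval.\<close>

lemma shuffle_words_iff:
  assumes "distinct w" "set w = {s + 1..s + sum_list I}"
  shows "w \<in> shuffle_words s I \<longleftrightarrow>
    (\<forall>p<length I. sorted (filter (\<lambda>b. b \<in> {s + psum I p + 1..s + psum I (Suc p)}) w))"
  using assms
proof (induction s I arbitrary: w rule: shuffle_words.induct)
  case (2 s i I)
  let ?u = "filter (\<lambda>b. b \<le> s + i) w" and ?v = "filter (\<lambda>b. b > s + i) w"
  have u: "distinct ?u" "set ?u = {s + 1..s + i}" using 2 by auto
  have v: "distinct ?v" "set ?v = {s + i + 1..s + i + sum_list I}" using 2 by auto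
  have "w \<in> shuffle_words s (i # I) \<longleftrightarrow> ?u = [s + 1..<s + i + 1] \<and> ?v \<in> shuffle_words (s + i) I"
  proof
    assume "w \<in> shuffle_words s (i # I)"
    then obtain w' where w': "w' \<in> shuffle_words (s + i) I" "w \<in> shuffles [s + 1..<s + i + 1] w'"
      by auto
    moreover have "\<forall>y\<in>set w'. s + i < y" using shuffle_words_set[OF w'(1)] by auto
    ultimately show "?u = [s + 1..<s + i + 1] \<and> ?v \<in> shuffle_words (s + i) I"
      using filter_shuffle_block by blast
  next
    assume "?u = [s + 1..<s + i + 1] \<and> ?v \<in> shuffle_words (s + i) I"
    \<comment> \<open>Every word is a shuffle of its small and its large letters.\<close>
    then show "w \<in> shuffle_words s (i # I)"
      using partition_in_shuffles[of w "\<lambda>b. b \<le> s + i"] by (auto simp: not_le simp del: upt_Suc)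
  qed
  also have "?u = [s + 1..<s + i + 1] \<longleftrightarrow> sorted ?u"
  proof
    assume "sorted ?u"
    moreover have "set ?u = set [s + 1..<s + i + 1]" unfolding u(2) by auto
    ultimately show "?u = [s + 1..<s + i + 1]"
      using u(1) by (metis sorted_distinct_set_unique sorted_upt distinct_upt)
  next
    assume "?u = [s + 1..<s + i + 1]"
    then show "sorted ?u" by (metis sorted_upt)
  qed
  also have "?u = filter (\<lambda>b. b \<in> {s + psum (i # I) 0 + 1..s + psum (i # I) (Suc 0)}) w"
    using 2(3) by (intro filter_cong) (auto simp: psum_def)
  also have "?v \<in> shuffle_words (s + i) I \<longleftrightarrow> (\<forall>p<length I.
      sorted (filter (\<lambda>b. b \<in> {s + i + psum I p + 1..s + i + psum I (Suc p)}) ?v))"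
    using 2(1)[OF v] .
  \<comment> \<open>The later blocks lie above \<open>s + i\<close>, so filtering \<open>?v\<close>
    or \<open>w\<close> for them gives the same list.\<close>
  also have "\<dots> \<longleftrightarrow> (\<forall>p<length I. sorted (filter
      (\<lambda>b. b \<in> {s + psum (i # I) (Suc p) + 1..s + psum (i # I) (Suc (Suc p))}) w))"
    by (intro all_cong arg_cong[of _ _ sorted])
       (auto simp: psum_def add.assoc intro!: filter_cong)
  finally show ?case
    by (simp only: length_Cons All_less_Suc2)
qed auto

section \<open>Permutations as words\<close>

definition word :: "nat \<Rightarrow> (nat \<Rightarrow> nat) \<Rightarrow> nat list"
  where "word n \<sigma> = map \<sigma> [1..<n + 1]"

lemma sorted_wrt_iff_increasing:
  assumes "sorted_wrt (<) (xs :: 'a::linorder list)"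
  shows "sorted_wrt R xs \<longleftrightarrow> (\<forall>x\<in>set xs. \<forall>y\<in>set xs. x < y \<longrightarrow> R x y)"
  using assms
proof (induction xs)
  case (Cons a xs)
  then have "\<forall>y\<in>set xs. a < y \<and> \<not> y < a" by (auto simp: order.asym)
  with Cons show ?case by auto
qed simp

text \<open>\<open>inv \<sigma>\<close> gives the positions of letters. As letters and positions are
  distinct, "earlier implies smaller" and "smaller implies earlier" are contrapositives.\<close>

lemma sorted_filter_word_iff:
  assumes "\<sigma> permutes {1..n}" "A \<subseteq> {1..n}"
  shows "sorted (filter (\<lambda>b. b \<in> A) (word n \<sigma>)) \<longleftrightarrow> strict_mono_on A (inv \<sigma>)"
proof -
  have [simp]: "\<sigma> (inv \<sigma> b) = b" "inv \<sigma> (\<sigma> b) = b" for b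
    using permutes_inverses[OF assms(1)] by auto
  have mem: "\<sigma> j \<in> {1..n} \<longleftrightarrow> j \<in> {1..n}" for j
    using permutes_in_image[OF assms(1)] .
  have "sorted (filter (\<lambda>b. b \<in> A) (word n \<sigma>)) \<longleftrightarrow>
      (\<forall>j k. 1 \<le> j \<and> j < k \<and> k \<le> n \<and> \<sigma> j \<in> A \<and> \<sigma> k \<in> A \<longrightarrow> \<sigma> j \<le> \<sigma> k)"
    unfolding word_def filter_map sorted_map
    by (subst sorted_wrt_iff_increasing) (auto intro!: sorted_wrt_filter simp del: upt_Suc)
  also have "\<dots> \<longleftrightarrow> strict_mono_on A (inv \<sigma>)"
  proof (intro iffI strict_mono_onI allI impI)
    fix a b assume *: "\<forall>j k. 1 \<le> j \<and> j < k \<and> k \<le> n \<and> \<sigma> j \<in> A \<and> \<sigma> k \<in> A \<longrightarrow> \<sigma> j \<le> \<sigma> k"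
      and ab: "a \<in> A" "b \<in> A" "a < b"
    show "inv \<sigma> a < inv \<sigma> b"
    proof (rule ccontr)
      assume "\<not> inv \<sigma> a < inv \<sigma> b"
      moreover have "inv \<sigma> a \<noteq> inv \<sigma> b" using ab by (metis permutes_inverses(1)[OF assms(1)] less_irrefl)
      moreover have "inv \<sigma> a \<in> {1..n}" "inv \<sigma> b \<in> {1..n}"
        using ab assms(2) mem[of "inv \<sigma> a"] mem[of "inv \<sigma> b"] by auto
      ultimately show False
        using *[rule_format, of "inv \<sigma> b" "inv \<sigma> a"] ab by auto
    qed
  next
    fix j k assume *: "strict_mono_on A (inv \<sigma>)" "1 \<le> j \<and> j < k \<and> k \<le> n \<and> \<sigma> j \<in> A \<and> \<sigma> k \<in> A"
    then show "\<sigma> j \<le> \<sigma> k"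
      using strict_mono_onD[of A "inv \<sigma>" "\<sigma> k" "\<sigma> j"] by (force simp: not_le)
  qed
  finally show ?thesis .
qed

lemma bij_betw_word_shuffle_ids:
  "bij_betw (word (sum_list I)) (shuffle_ids I) (shuffle_words 0 I)"
proof -
  let ?n = "sum_list I"
  have iff: "word ?n \<sigma> \<in> shuffle_words 0 I \<longleftrightarrow> \<sigma> \<in> shuffle_ids I" if \<sigma>: "\<sigma> permutes {1..?n}" for \<sigma>
  proof -
    have "distinct (word ?n \<sigma>)" "set (word ?n \<sigma>) = {0 + 1..0 + ?n}"
      using permutes_image[OF \<sigma>] permutes_inj_on[OF \<sigma>]
      by (auto simp: word_def distinct_map atLeastLessThanSuc_atLeastAtMost simp del: upt_Suc)
    then have "word ?n \<sigma> \<in> shuffle_words 0 I \<longleftrightarrow>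
        (\<forall>p<length I. sorted (filter (\<lambda>b. b \<in> {psum I p + 1..psum I (Suc p)}) (word ?n \<sigma>)))"
      using shuffle_words_iff[of "word ?n \<sigma>" 0 I] by simp
    also have "\<dots> \<longleftrightarrow> (\<forall>p<length I. strict_mono_on {psum I p + 1..psum I (Suc p)} (inv \<sigma>))"
    proof (intro all_cong sorted_filter_word_iff[OF \<sigma>])
      fix p
      have "psum I (Suc p) \<le> ?n"
        by (metis psum_def append_take_drop_id le_add1 sum_list_append)
      then show "{psum I p + 1..psum I (Suc p)} \<subseteq> {1..?n}" by auto
    qed
    also have "\<dots> \<longleftrightarrow> \<sigma> \<in> shuffle_ids I"
    proof -
      \<comment> \<open>Blocks are counted from 0 in \<open>shuffle_words_iff\<close> but from 1 in
        \<open>shuffle_ids\<close>.\<close>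
      have "(\<forall>p<length I. Q p (Suc p)) \<longleftrightarrow> (\<forall>p. 1 \<le> p \<and> p \<le> length I \<longrightarrow> Q (p - 1) p)" for Q
        by (metis One_nat_def Suc_le_eq diff_Suc_1 not0_implies_Suc zero_less_Suc less_numeral_extra(3))
      from this[of "\<lambda>p q. strict_mono_on {psum I p + 1..psum I q} (inv \<sigma>)"] show ?thesis
        using \<sigma> unfolding shuffle_ids_def by blast
    qed
    finally show ?thesis .
  qed
  show ?thesis
  proof (rule bij_betwI')
    fix \<sigma> \<tau> assume "\<sigma> \<in> shuffle_ids I" "\<tau> \<in> shuffle_ids I"
    then have *: "\<sigma> permutes {1..?n}" "\<tau> permutes {1..?n}" by (auto simp: shuffle_ids_def)
    show "word ?n \<sigma> = word ?n \<tau> \<longleftrightarrow> \<sigma> = \<tau>"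
    proof
      assume "word ?n \<sigma> = word ?n \<tau>"
      then have "\<forall>x\<in>{1..?n}. \<sigma> x = \<tau> x" by (auto simp: word_def simp del: upt_Suc)
      then show "\<sigma> = \<tau>" using * by (metis ext permutes_not_in)
    qed simp
  next
    fix \<sigma> assume "\<sigma> \<in> shuffle_ids I"
    then show "word ?n \<sigma> \<in> shuffle_words 0 I" using iff by (auto simp: shuffle_ids_def)
  next
    fix w assume w: "w \<in> shuffle_words 0 I"
    then have d: "distinct w" "set w = {1..?n}" using shuffle_words_set[OF w] by auto
    then have len: "length w = ?n" using distinct_card[of w] by simp
    \<comment> \<open>Read \<open>w\<close> as a function, shifting from 1-based positions to
      0-based list indices, and fix everything outside.\<close>
    define \<sigma> where "\<sigma> j = (if j \<in> {1..?n} then w ! (j - 1) else j)" for j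
    have weq: "word ?n \<sigma> = w"
      by (rule nth_equalityI) (auto simp: word_def \<sigma>_def len simp del: upt_Suc)
    have "inj_on \<sigma> {1..?n}"
      using d len by (auto simp: inj_on_def \<sigma>_def nth_eq_iff_index_eq)
    moreover have "\<sigma> ` {1..?n} = {1..?n}"
    proof -
      have "\<sigma> ` {1..?n} = set (word ?n \<sigma>)"
        by (auto simp: word_def simp del: upt_Suc)
      then show ?thesis using weq d by simp
    qed
    ultimately have "\<sigma> permutes {1..?n}"
      by (intro bij_imp_permutes) (auto simp: bij_betw_def \<sigma>_def)
    with iff w weq show "\<exists>\<sigma>\<in>shuffle_ids I. w = word ?n \<sigma>" by metis
  qed
qed

section \<open>The saillance code as a gap code\<close>

text \<open>Each larger letter overwrites the accumulator, so the rightmost one decides.\<close>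

lemma fold_last_larger:
  "fold (\<lambda>z g. if z > i then N - z else g) (map \<sigma> [1..<m]) g
    = (let J = {j. 1 \<le> j \<and> j < m \<and> \<sigma> j > i} in if J = {} then g else N - \<sigma> (Max J))"
proof (induction m)
  case (Suc m)
  let ?J = "\<lambda>m. {j. 1 \<le> j \<and> j < m \<and> \<sigma> j > i}"
  show ?case
  proof (cases "1 \<le> m \<and> \<sigma> m > i")
    case True
    then have "Max (?J (Suc m)) = m" by (intro Max_eqI) auto
    moreover have "m \<in> ?J (Suc m)" using True by simp
    ultimately show ?thesis using True by (auto simp: Let_def)
  next
    case False
    then have "?J (Suc m) = ?J m" by (auto simp: less_Suc_eq)
    with False Suc show ?thesis by (cases "m = 0") auto
  qed
qed simp

text \<open>Cut the word at the letter \<open>i\<close>: the prefix is exactly what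
  \<open>larger_left\<close> inspects.\<close>

lemma saillance_code_eq_gap_code:
  assumes \<sigma>: "\<sigma> permutes {1..n}"
  shows "saillance_code n \<sigma> = map (gap_code (n + 1) 0 (word n \<sigma>)) [1..<n + 1]"
  unfolding saillance_code_def
proof (rule map_cong[OF refl])
  fix i assume "i \<in> set [1..<n + 1]"
  then have i: "i \<in> {1..n}" by auto
  define m where "m = inv \<sigma> i"
  have \<sigma>m: "\<sigma> m = i" using permutes_inverses[OF \<sigma>] by (simp add: m_def)
  with i permutes_in_image[OF \<sigma>, of m] have m: "1 \<le> m" "m \<le> n" by auto
  then have "[1..<n + 1] = [1..<m] @ m # [m + 1..<n + 1]"
    using upt_add_eq_append[of 1 m "n + 1 - m"] upt_conv_Cons[of m "n + 1"] by simp
  then have "word n \<sigma> = map \<sigma> [1..<m] @ i # map \<sigma> [m + 1..<n + 1]"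
    using \<sigma>m by (simp add: word_def del: upt_Suc)
  moreover have "i \<notin> set (map \<sigma> [1..<m])"
    using \<sigma>m permutes_inj[OF \<sigma>] by (auto simp: inj_eq)
  ultimately show "(if larger_left \<sigma> i = {} then 0 else n + 1 - \<sigma> (Max (larger_left \<sigma> i)))
      = gap_code (n + 1) 0 (word n \<sigma>) i"
    by (simp only: gap_code_append fold_last_larger larger_left_def m_def Let_def not_False_eq_True)
qed

section \<open>Descent sets and passage to inverses\<close>

lemma psum_mono: "p \<le> q \<Longrightarrow> psum I p \<le> psum I q"
proof -
  assume "p \<le> q"
  then have "take q I = take p I @ take (q - p) (drop p I)"
    by (metis le_add_diff_inverse take_add)
  then show ?thesis by (simp add: psum_def)
qed

text \<open>The allowed descents are the block boundaries, so the condition says that each block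
  ascends. Injectivity turns a non-descent into a strict ascent.\<close>

lemma descent_set_subset_iff:
  assumes "inj \<sigma>"
  shows "descent_set (sum_list I) \<sigma> \<subseteq> {psum I p | p. 1 \<le> p \<and> p < length I} \<longleftrightarrow>
    (\<forall>p. 1 \<le> p \<and> p \<le> length I \<longrightarrow> strict_mono_on {psum I (p - 1) + 1..psum I p} \<sigma>)"
  (is "?L \<longleftrightarrow> ?R")
proof
  assume L: ?L
  show ?R
  proof (intro allI impI)
    fix p assume p: "1 \<le> p \<and> p \<le> length I"
    have step: "\<sigma> j < \<sigma> (Suc j)" if j: "psum I (p - 1) < j" "j < psum I p" for j
    proof (rule ccontr)
      assume "\<not> \<sigma> j < \<sigma> (Suc j)"
      moreover have "\<sigma> j \<noteq> \<sigma> (Suc j)" using assms by (simp add: inj_eq)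
      moreover have "psum I p \<le> sum_list I"
        using psum_mono[of p "length I" I] p by (simp add: psum_def)
      ultimately have "j \<in> descent_set (sum_list I) \<sigma>" using j by (auto simp: descent_set_def)
      with L obtain q where q: "j = psum I q" by auto
      \<comment> \<open>By monotonicity, no partial sum lies strictly between two consecutive
        ones.\<close>
      have "q \<le> p - 1 \<or> p \<le> q" by linarith
      then show False
        using psum_mono[of q "p - 1" I] psum_mono[of p q I] q j by auto
    qed
    \<comment> \<open>Chain the adjacent ascents, by induction on the distance.\<close>
    have "psum I (p - 1) < a \<Longrightarrow> a + Suc d \<le> psum I p \<Longrightarrow> \<sigma> a < \<sigma> (a + Suc d)" for a d
    proof (induction d)
      case 0
      then show ?case using step[of a] by simp
    next
      case (Suc d)
      then show ?case using step[of "a + Suc d"] by simp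
    qed
    then show "strict_mono_on {psum I (p - 1) + 1..psum I p} \<sigma>"
      by (intro strict_mono_onI) (metis Suc_eq_plus1 Suc_le_eq atLeastAtMost_iff less_imp_Suc_add add_Suc_right)
  qed
next
  assume R: ?R
  show ?L
  proof
    fix j assume j: "j \<in> descent_set (sum_list I) \<sigma>"
    then have "j < psum I (length I)" by (simp add: descent_set_def psum_def)
    \<comment> \<open>The position \<open>j + 1\<close> lies in block \<open>p\<close>. If
      \<open>j\<close> is in that block too, the ascent there contradicts the descent; hence
      \<open>j\<close> is the end of the preceding block.\<close>
    define p where "p = (LEAST p. j < psum I p)"
    have p: "j < psum I p" "p \<le> length I"
      unfolding p_def using \<open>j < psum I (length I)\<close> by (auto intro: LeastI Least_le)
    then have p0: "p \<noteq> 0" by (auto simp: psum_def intro: ccontr)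
    then have ge: "psum I (p - 1) \<le> j"
      using not_less_Least[of "p - 1" "\<lambda>p. j < psum I p"] by (auto simp: p_def)
    have "\<not> psum I (p - 1) < j"
    proof
      assume "psum I (p - 1) < j"
      with p p0 have "\<sigma> j < \<sigma> (j + 1)"
        by (intro strict_mono_onD[OF R[rule_format, of p]]) auto
      with j show False by (simp add: descent_set_def)
    qed
    with ge have "j = psum I (p - 1)" by simp
    moreover have "p - 1 \<noteq> 0"
      using calculation j by (auto simp: descent_set_def psum_def)
    ultimately show "j \<in> {psum I p | p. 1 \<le> p \<and> p < length I}" using p p0 by force
  qed
qed

text \<open>The shuffle condition on \<open>inv \<sigma>\<close> constrains
  \<open>inv (inv \<sigma>) = \<sigma>\<close>, where it becomes the descent condition.\<close>

lemma bij_betw_inv_D_le: "bij_betw inv (D_le I) (shuffle_ids I)"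
proof (rule bij_betw_byWitness[where f' = inv])
  have inv_inv: "inv (inv \<sigma>) = \<sigma>" if "\<sigma> permutes S" for \<sigma> :: "nat \<Rightarrow> nat" and S
    using that by (simp add: permutes_bij inv_inv_eq)
  show "\<forall>\<sigma>\<in>D_le I. inv (inv \<sigma>) = \<sigma>" "\<forall>\<sigma>\<in>shuffle_ids I. inv (inv \<sigma>) = \<sigma>"
    by (auto simp: D_le_def shuffle_ids_def inv_inv)
  have "inv \<sigma> \<in> shuffle_ids I" if "\<sigma> \<in> D_le I" for \<sigma>
  proof -
    have \<sigma>: "\<sigma> permutes {1..sum_list I}" using that by (simp add: D_le_def)
    then show ?thesis
      using that permutes_inv[OF \<sigma>] descent_set_subset_iff[OF permutes_inj[OF \<sigma>], of I]
      unfolding D_le_def shuffle_ids_def inv_inv[OF \<sigma>] mem_Collect_eq by blast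
  qed
  then show "inv ` D_le I \<subseteq> shuffle_ids I" by blast
  have "inv \<sigma> \<in> D_le I" if "\<sigma> \<in> shuffle_ids I" for \<sigma>
  proof -
    have "inv \<sigma> permutes {1..sum_list I}"
      using that by (simp add: shuffle_ids_def permutes_inv)
    then show ?thesis
      using that descent_set_subset_iff[OF permutes_inj, of "inv \<sigma>" "{1..sum_list I}" I]
      unfolding D_le_def shuffle_ids_def mem_Collect_eq by blast
  qed
  then show "inv ` shuffle_ids I \<subseteq> D_le I" by blast
qed

theorem mainTheorem3:
  fixes I :: "nat list" and n :: nat
  assumes "is_composition I n"
  shows "(\<Sum>\<sigma>\<in>D_le I. x_word (saillance_code n (inv \<sigma>)) :: 'a::comm_ring_1 mpoly)
           = (\<Sum>\<sigma>\<in>shuffle_ids I. x_word (saillance_code n \<sigma>))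
       \<and> (\<Sum>\<sigma>\<in>shuffle_ids I. x_word (saillance_code n \<sigma>) :: 'a mpoly)
           = (\<Prod>p<length I. complete_hom (I ! p) (sum_list (drop (p + 1) I)))"
proof
  have n: "n = sum_list I" using assms by (simp add: is_composition_def)
  show "(\<Sum>\<sigma>\<in>D_le I. x_word (saillance_code n (inv \<sigma>)) :: 'a mpoly)
      = (\<Sum>\<sigma>\<in>shuffle_ids I. x_word (saillance_code n \<sigma>))"
    using bij_betw_inv_D_le by (rule sum.reindex_bij_betw)
  have "(\<Sum>\<sigma>\<in>shuffle_ids I. x_word (saillance_code n \<sigma>) :: 'a mpoly)
      = (\<Sum>\<sigma>\<in>shuffle_ids I. \<Prod>i\<leftarrow>[0 + 1..<n + 1]. indet (gap_code (n + 1) 0 (word n \<sigma>) i))"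
    by (intro sum.cong refl)
       (auto simp: shuffle_ids_def n saillance_code_eq_gap_code x_word_def o_def simp del: upt_Suc)
  also have "\<dots> = (\<Sum>w\<in>shuffle_words 0 I. \<Prod>i\<leftarrow>[0 + 1..<n + 1]. indet (gap_code (n + 1) 0 w i))"
    unfolding n using bij_betw_word_shuffle_ids by (rule sum.reindex_bij_betw)
  also have "\<dots> = (\<Prod>p<length I. complete_hom (I ! p) (sum_list (drop (p + 1) I)))"
    unfolding complete_hom_eq_hsum by (rule sum_shuffle_words_gap_code) (simp add: n)
  finally show "(\<Sum>\<sigma>\<in>shuffle_ids I. x_word (saillance_code n \<sigma>) :: 'a mpoly)
      = (\<Prod>p<length I. complete_hom (I ! p) (sum_list (drop (p + 1) I)))" .
qed

end
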